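(* Let $\Gamma$, $t$, $A$ be an environment, a System F term and a System F type none of which contains free type-variables (eigenvariables may occur). If $\Gamma \vdash t : A$ is derivable in System F, then $\mathrm{ver}_A(t^{\Gamma}) \twoheadrightarrow \star$ in the metacalculus $\lambda^{\mathsf F}_{\mathfrak m}$.
   Context: There are disjoint denumerable sets of type-variables $a,b,\dots$ and eigenvariables $\mathbf{a},\mathbf{b},\dots$. Types: $A,B ::= a \mid \mathbf{a} \mid A\Rightarrow B \mid \forall a.A$ ($\forall a$ binds $a$; eigenvariables are never bound in types or terms). Terms: $t ::= x \mid \lambda x.t \mid t\,s \mid \Lambda a.t \mid t\,A$. Environments $\Gamma$ are finite sets of assignments $x:A$ to distinct variables. Typing: $\Gamma,x:A\vdash x:A$; from $\Gamma,x:A\vdash t:B$ infer $\Gamma\vdash\lambda x.t:A\Rightarrow B$; from $\Gamma\vdash t:A\Rightarrow B$ and $\Gamma\vdash s:A$ infer $\Gamma\vdash t\,s:B$; from $\Gamma\vdash t:A$ with $a$ not free in $\Gamma$ infer $\Gamma\vdash\Lambda a.t:\forall a.A$; from $\Gamma\vdash t:\forall a.A$ infer $\Gamma\vdash t\,B:A\{a:=B\}$. Metaterms of $\lambda^{\mathsf F}_{\mathfrak m}$: $M,N ::= x \mid \lambda x.M \mid M\,N \mid \Lambda a.M \mid M\,A \mid \star \mid (M\triangleright N) \mid \mathrm{gen}_A \mid \mathrm{ver}_A(M) \mid \nu\mathbf{a}.M$ for arbitrary types $A$ ($\nu\mathbf{a}$ binds the eigenvariable $\mathbf{a}$ in $M$;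 terms are identified with metaterms using only the first five productions). Reduction $\to$ is the closure under arbitrary contexts of: (1) $(\lambda x.M)N\to M\{x:=N\}$; (2) $(\Lambda a.M)A\to M\{a:=A\}$; (3) $(\star\triangleright M)\to M$; (4) $\mathrm{ver}_{\mathbf{a}}(\mathrm{gen}_{\mathbf{a}})\to\star$ for eigenvariables $\mathbf{a}$; (5) $\mathrm{gen}_{A\Rightarrow B}\to\lambda x.(\mathrm{ver}_A(x)\triangleright\mathrm{gen}_B)$; (6) $\mathrm{ver}_{A\Rightarrow B}(M)\to\mathrm{ver}_B(M\,\mathrm{gen}_A)$; (7) $\mathrm{gen}_{\forall a.A}\to\Lambda a.\mathrm{gen}_A$; (8) $\mathrm{ver}_{\forall a.A}(M)\to\nu\mathbf{a}.\mathrm{ver}_{A\{a:=\mathbf{a}\}}(M\,\mathbf{a})$ with $\mathbf{a}$ fresh; (9) $\nu\mathbf{a}.M\to M$ if $\mathbf{a}$ is not free in $M$. $\twoheadrightarrow$ is the reflexive-transitive closure. $t^{\Gamma}$ denotes $t$ with every free occurrence of each variable $x$ with $x:A\in\Gamma$ replaced by $\mathrm{gen}_A$ (other variables unchanged). *)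

theory Defs
  imports Main
begin

text \<open>
  Expressions are taken up to renaming of bound names, so all three kinds of names (type-variables,
  eigenvariables, term variables) are de Bruijn indices, each kind with its own index space.
  Index \<open>n\<close> below \<open>k\<close> enclosing binders of its own kind is bound if \<open>n < k\<close> and otherwise stands for
  the free name \<open>n - k\<close>. Term variables are bound by \<open>Lam\<close>, type-variables by \<open>All\<close> and
  \<open>TLam\<close>, eigenvariables by \<open>Nu\<close> only.
\<close>

datatype ty =
    TVar nat
  | Eig nat
  | Fun ty ty  (infixr \<open>\<rightarrow>\<^sub>T\<close> 65)
  | All ty

datatype mterm =
    Var nat
  | Lam mterm
  | App mterm mterm
  | TLam mterm
  | TApp mterm ty
  | Star
  | Seq mterm mterm  (infixr \<open>\<triangleright>\<close> 60)
  | Gen ty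
  | Ver ty mterm
  | Nu mterm

text \<open>The System F terms, identified with the metaterms using only the first five productions.\<close>

primrec is_term :: "mterm \<Rightarrow> bool" where
  "is_term (Var n) \<longleftrightarrow> True"
| "is_term (Lam M) \<longleftrightarrow> is_term M"
| "is_term (App M N) \<longleftrightarrow> is_term M \<and> is_term N"
| "is_term (TLam M) \<longleftrightarrow> is_term M"
| "is_term (TApp M A) \<longleftrightarrow> is_term M"
| "is_term Star \<longleftrightarrow> False"
| "is_term (M \<triangleright> N) \<longleftrightarrow> False"
| "is_term (Gen A) \<longleftrightarrow> False"
| "is_term (Ver A M) \<longleftrightarrow> False"
| "is_term (Nu M) \<longleftrightarrow> False"


subsection \<open>Free type-variables\<close>

primrec ty_ftv :: "ty \<Rightarrow> nat set" where
  "ty_ftv (TVar n) = {n}"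
| "ty_ftv (Eig n) = {}"
| "ty_ftv (A \<rightarrow>\<^sub>T B) = ty_ftv A \<union> ty_ftv B"
| "ty_ftv (All A) = {n. Suc n \<in> ty_ftv A}"

primrec mt_ftv :: "mterm \<Rightarrow> nat set" where
  "mt_ftv (Var n) = {}"
| "mt_ftv (Lam M) = mt_ftv M"
| "mt_ftv (App M N) = mt_ftv M \<union> mt_ftv N"
| "mt_ftv (TLam M) = {n. Suc n \<in> mt_ftv M}"
| "mt_ftv (TApp M A) = mt_ftv M \<union> ty_ftv A"
| "mt_ftv Star = {}"
| "mt_ftv (M \<triangleright> N) = mt_ftv M \<union> mt_ftv N"
| "mt_ftv (Gen A) = ty_ftv A"
| "mt_ftv (Ver A M) = ty_ftv A \<union> mt_ftv M"
| "mt_ftv (Nu M) = mt_ftv M"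


subsection \<open>Renaming and capture-avoiding simultaneous substitution\<close>

text \<open>Passing under a binder: the new index \<open>0\<close> is kept and every free index is shifted by one.\<close>

definition up :: "(nat \<Rightarrow> nat) \<Rightarrow> nat \<Rightarrow> nat" where
  "up f = case_nat 0 (\<lambda>n. Suc (f n))"

primrec ty_tren :: "(nat \<Rightarrow> nat) \<Rightarrow> ty \<Rightarrow> ty" where
  "ty_tren f (TVar n) = TVar (f n)"
| "ty_tren f (Eig n) = Eig n"
| "ty_tren f (A \<rightarrow>\<^sub>T B) = ty_tren f A \<rightarrow>\<^sub>T ty_tren f B"
| "ty_tren f (All A) = All (ty_tren (up f) A)"

primrec ty_eren :: "(nat \<Rightarrow> nat) \<Rightarrow> ty \<Rightarrow> ty" where
  "ty_eren f (TVar n) = TVar n"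
| "ty_eren f (Eig n) = Eig (f n)"
| "ty_eren f (A \<rightarrow>\<^sub>T B) = ty_eren f A \<rightarrow>\<^sub>T ty_eren f B"
| "ty_eren f (All A) = All (ty_eren f A)"

primrec ty_tsubst :: "(nat \<Rightarrow> ty) \<Rightarrow> ty \<Rightarrow> ty" where
  "ty_tsubst \<sigma> (TVar n) = \<sigma> n"
| "ty_tsubst \<sigma> (Eig n) = Eig n"
| "ty_tsubst \<sigma> (A \<rightarrow>\<^sub>T B) = ty_tsubst \<sigma> A \<rightarrow>\<^sub>T ty_tsubst \<sigma> B"
| "ty_tsubst \<sigma> (All A) = All (ty_tsubst (case_nat (TVar 0) (\<lambda>n. ty_tren Suc (\<sigma> n))) A)"

primrec mt_vren :: "(nat \<Rightarrow> nat) \<Rightarrow> mterm \<Rightarrow> mterm" where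
  "mt_vren f (Var n) = Var (f n)"
| "mt_vren f (Lam M) = Lam (mt_vren (up f) M)"
| "mt_vren f (App M N) = App (mt_vren f M) (mt_vren f N)"
| "mt_vren f (TLam M) = TLam (mt_vren f M)"
| "mt_vren f (TApp M A) = TApp (mt_vren f M) A"
| "mt_vren f Star = Star"
| "mt_vren f (M \<triangleright> N) = mt_vren f M \<triangleright> mt_vren f N"
| "mt_vren f (Gen A) = Gen A"
| "mt_vren f (Ver A M) = Ver A (mt_vren f M)"
| "mt_vren f (Nu M) = Nu (mt_vren f M)"

primrec mt_eren :: "(nat \<Rightarrow> nat) \<Rightarrow> mterm \<Rightarrow> mterm" where
  "mt_eren f (Var n) = Var n"
| "mt_eren f (Lam M) = Lam (mt_eren f M)"
| "mt_eren f (App M N) = App (mt_eren f M) (mt_eren f N)"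
| "mt_eren f (TLam M) = TLam (mt_eren f M)"
| "mt_eren f (TApp M A) = TApp (mt_eren f M) (ty_eren f A)"
| "mt_eren f Star = Star"
| "mt_eren f (M \<triangleright> N) = mt_eren f M \<triangleright> mt_eren f N"
| "mt_eren f (Gen A) = Gen (ty_eren f A)"
| "mt_eren f (Ver A M) = Ver (ty_eren f A) (mt_eren f M)"
| "mt_eren f (Nu M) = Nu (mt_eren (up f) M)"

primrec mt_tsubst :: "(nat \<Rightarrow> ty) \<Rightarrow> mterm \<Rightarrow> mterm" where
  "mt_tsubst \<sigma> (Var n) = Var n"
| "mt_tsubst \<sigma> (Lam M) = Lam (mt_tsubst \<sigma> M)"
| "mt_tsubst \<sigma> (App M N) = App (mt_tsubst \<sigma> M) (mt_tsubst \<sigma> N)"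
| "mt_tsubst \<sigma> (TLam M) = TLam (mt_tsubst (case_nat (TVar 0) (\<lambda>n. ty_tren Suc (\<sigma> n))) M)"
| "mt_tsubst \<sigma> (TApp M A) = TApp (mt_tsubst \<sigma> M) (ty_tsubst \<sigma> A)"
| "mt_tsubst \<sigma> Star = Star"
| "mt_tsubst \<sigma> (M \<triangleright> N) = mt_tsubst \<sigma> M \<triangleright> mt_tsubst \<sigma> N"
| "mt_tsubst \<sigma> (Gen A) = Gen (ty_tsubst \<sigma> A)"
| "mt_tsubst \<sigma> (Ver A M) = Ver (ty_tsubst \<sigma> A) (mt_tsubst \<sigma> M)"
| "mt_tsubst \<sigma> (Nu M) = Nu (mt_tsubst (\<lambda>n. ty_eren Suc (\<sigma> n)) M)"

primrec mt_subst :: "(nat \<Rightarrow> mterm) \<Rightarrow> mterm \<Rightarrow> mterm" where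
  "mt_subst \<sigma> (Var n) = \<sigma> n"
| "mt_subst \<sigma> (Lam M) = Lam (mt_subst (case_nat (Var 0) (\<lambda>n. mt_vren Suc (\<sigma> n))) M)"
| "mt_subst \<sigma> (App M N) = App (mt_subst \<sigma> M) (mt_subst \<sigma> N)"
| "mt_subst \<sigma> (TLam M) = TLam (mt_subst (\<lambda>n. mt_tsubst (\<lambda>i. TVar (Suc i)) (\<sigma> n)) M)"
| "mt_subst \<sigma> (TApp M A) = TApp (mt_subst \<sigma> M) A"
| "mt_subst \<sigma> Star = Star"
| "mt_subst \<sigma> (M \<triangleright> N) = mt_subst \<sigma> M \<triangleright> mt_subst \<sigma> N"
| "mt_subst \<sigma> (Gen A) = Gen A"
| "mt_subst \<sigma> (Ver A M) = Ver A (mt_subst \<sigma> M)"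
| "mt_subst \<sigma> (Nu M) = Nu (mt_subst (\<lambda>n. mt_eren Suc (\<sigma> n)) M)"

text \<open>
  Instantiation of the outermost bound index, \<open>A{a:=B}\<close>, \<open>M{a:=B}\<close> and \<open>M{x:=N}\<close>: the remaining
  free indices move down by one since their binder is gone.
\<close>

definition ty_tinst :: "ty \<Rightarrow> ty \<Rightarrow> ty" where
  "ty_tinst B = ty_tsubst (case_nat B TVar)"

definition mt_tinst :: "ty \<Rightarrow> mterm \<Rightarrow> mterm" where
  "mt_tinst B = mt_tsubst (case_nat B TVar)"

definition mt_inst :: "mterm \<Rightarrow> mterm \<Rightarrow> mterm" where
  "mt_inst N = mt_subst (case_nat N Var)"


subsection \<open>Typing\<close>

text \<open>An environment is a finite partial map from term variables to types.\<close>

type_synonym env = "nat \<rightharpoonup> ty"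

text \<open>
  In rule \<open>TLam\<close> the types of \<open>\<Gamma>\<close> are shifted into the scope of the abstracted type-variable, which
  therefore does not occur free in them.
\<close>

inductive typing :: "env \<Rightarrow> mterm \<Rightarrow> ty \<Rightarrow> bool"  (\<open>_ \<turnstile> _ : _\<close> [50, 50, 50] 50) where
  Var: "\<Gamma> n = Some A \<Longrightarrow> \<Gamma> \<turnstile> Var n : A"
| Lam: "case_nat (Some A) \<Gamma> \<turnstile> t : B \<Longrightarrow> \<Gamma> \<turnstile> Lam t : (A \<rightarrow>\<^sub>T B)"
| App: "\<Gamma> \<turnstile> t : (A \<rightarrow>\<^sub>T B) \<Longrightarrow> \<Gamma> \<turnstile> s : A \<Longrightarrow> \<Gamma> \<turnstile> App t s : B"
| TLam: "(\<lambda>n. map_option (ty_tren Suc) (\<Gamma> n)) \<turnstile> t : A \<Longrightarrow> \<Gamma> \<turnstile> TLam t : All A"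
| TApp: "\<Gamma> \<turnstile> t : All A \<Longrightarrow> \<Gamma> \<turnstile> TApp t B : ty_tinst B A"


subsection \<open>Reduction\<close>

text \<open>
  In \<open>ver_All\<close> the expressions \<open>A\<close> and \<open>M\<close> are shifted under the new \<open>Nu\<close>, so the eigenvariable \<open>0\<close>
  is fresh for them. In \<open>nu\<close>, a body in which the bound eigenvariable does not occur is precisely
  one of the form \<open>mt_eren Suc M\<close>, where \<open>M\<close> is that body outside the scope of the binder.
\<close>

inductive step :: "mterm \<Rightarrow> mterm \<Rightarrow> bool"  (infix \<open>\<rightarrow>\<^sub>m\<close> 50) where
  beta: "App (Lam M) N \<rightarrow>\<^sub>m mt_inst N M"
| tbeta: "TApp (TLam M) A \<rightarrow>\<^sub>m mt_tinst A M"
| seq: "(Star \<triangleright> M) \<rightarrow>\<^sub>m M"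
| ver_gen: "Ver (Eig a) (Gen (Eig a)) \<rightarrow>\<^sub>m Star"
| gen_Fun: "Gen (A \<rightarrow>\<^sub>T B) \<rightarrow>\<^sub>m Lam (Ver A (Var 0) \<triangleright> Gen B)"
| ver_Fun: "Ver (A \<rightarrow>\<^sub>T B) M \<rightarrow>\<^sub>m Ver B (App M (Gen A))"
| gen_All: "Gen (All A) \<rightarrow>\<^sub>m TLam (Gen A)"
| ver_All: "Ver (All A) M \<rightarrow>\<^sub>m
    Nu (Ver (ty_tinst (Eig 0) (ty_eren Suc A)) (TApp (mt_eren Suc M) (Eig 0)))"
| nu: "Nu (mt_eren Suc M) \<rightarrow>\<^sub>m M"
| Lam: "M \<rightarrow>\<^sub>m M' \<Longrightarrow> Lam M \<rightarrow>\<^sub>m Lam M'"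
| AppL: "M \<rightarrow>\<^sub>m M' \<Longrightarrow> App M N \<rightarrow>\<^sub>m App M' N"
| AppR: "N \<rightarrow>\<^sub>m N' \<Longrightarrow> App M N \<rightarrow>\<^sub>m App M N'"
| TLam: "M \<rightarrow>\<^sub>m M' \<Longrightarrow> TLam M \<rightarrow>\<^sub>m TLam M'"
| TApp: "M \<rightarrow>\<^sub>m M' \<Longrightarrow> TApp M A \<rightarrow>\<^sub>m TApp M' A"
| SeqL: "M \<rightarrow>\<^sub>m M' \<Longrightarrow> (M \<triangleright> N) \<rightarrow>\<^sub>m (M' \<triangleright> N)"
| SeqR: "N \<rightarrow>\<^sub>m N' \<Longrightarrow> (M \<triangleright> N) \<rightarrow>\<^sub>m (M \<triangleright> N')"
| Ver: "M \<rightarrow>\<^sub>m M' \<Longrightarrow> Ver A M \<rightarrow>\<^sub>m Ver A M'"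
| Nu: "M \<rightarrow>\<^sub>m M' \<Longrightarrow> Nu M \<rightarrow>\<^sub>m Nu M'"

abbreviation steps :: "mterm \<Rightarrow> mterm \<Rightarrow> bool"  (infix \<open>\<rightarrow>\<^sub>m\<^sup>*\<close> 50) where
  "steps \<equiv> step\<^sup>*\<^sup>*"

text \<open>The metaterm \<open>t\<close> with superscript \<open>\<Gamma>\<close>.\<close>

definition gen_subst :: "env \<Rightarrow> mterm \<Rightarrow> mterm" where
  "gen_subst \<Gamma> = mt_subst (\<lambda>n. case \<Gamma> n of None \<Rightarrow> Var n | Some A \<Rightarrow> Gen A)"

end

theory Submission
  imports Defs
begin

text \<open>
  The proof is by Girard's reducibility candidates. A candidate of a closed type \<open>A\<close> is a set of
  metaterms without free variables and type-variables that is closed under expansion, contains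
  \<open>gen\<^sub>A\<close>, and all of whose elements \<open>M\<close> satisfy \<open>ver\<^sub>A(M) \<rightarrow>\<^sup>* \<star>\<close>. By the rules (3)--(9) these
  properties pass from the parts of a type to the whole. For the quantifier, \<open>M \<bold>a\<close> is
  reducible at a fresh eigenvariable \<open>\<bold>a\<close>, whose candidate is \<open>{M. ver\<^sub>\<bold>a(M) \<rightarrow>\<^sup>* \<star>}\<close>. Since every
  \<open>gen\<^sub>A\<close> is reducible, so is \<open>t\<^sup>\<Gamma>\<close>, by induction on the typing derivation.
\<close>

subsection \<open>Substitution in types\<close>

abbreviation ty_lift :: "(nat \<Rightarrow> ty) \<Rightarrow> nat \<Rightarrow> ty" where
  "ty_lift \<sigma> \<equiv> case_nat (TVar 0) (\<lambda>n. ty_tren Suc (\<sigma> n))"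

lemma up_simps [simp]: "up f 0 = 0" "up f (Suc n) = Suc (f n)"
  by (simp_all add: up_def)

lemma ty_tren_tren: "ty_tren f (ty_tren g A) = ty_tren (\<lambda>n. f (g n)) A"
proof (induction A arbitrary: f g)
  case (All A)
  have "(\<lambda>n. up f (up g n)) = up (\<lambda>n. f (g n))"
    by (rule ext) (simp split: nat.split add: up_def)
  with All show ?case by simp
qed auto

lemma ty_tsubst_tren: "ty_tsubst \<sigma> (ty_tren f A) = ty_tsubst (\<lambda>n. \<sigma> (f n)) A"
proof (induction A arbitrary: \<sigma> f)
  case (All A)
  have "(\<lambda>n. ty_lift \<sigma> (up f n)) = ty_lift (\<lambda>n. \<sigma> (f n))"
    by (rule ext) (simp split: nat.split add: up_def)
  with All show ?case by simp
qed auto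

lemma ty_tren_tsubst: "ty_tren f (ty_tsubst \<sigma> A) = ty_tsubst (\<lambda>n. ty_tren f (\<sigma> n)) A"
proof (induction A arbitrary: \<sigma> f)
  case (All A)
  have "(\<lambda>n. ty_tren (up f) (ty_lift \<sigma> n)) = ty_lift (\<lambda>n. ty_tren f (\<sigma> n))"
    by (rule ext) (simp split: nat.split add: ty_tren_tren)
  with All show ?case by simp
qed auto

lemma ty_lift_comp: "ty_tsubst (ty_lift \<tau>) (ty_lift \<sigma> n) = ty_lift (\<lambda>n. ty_tsubst \<tau> (\<sigma> n)) n"
  by (simp split: nat.split add: ty_tsubst_tren ty_tren_tsubst)

lemma ty_tsubst_tsubst: "ty_tsubst \<tau> (ty_tsubst \<sigma> A) = ty_tsubst (\<lambda>n. ty_tsubst \<tau> (\<sigma> n)) A"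
  by (induction A arbitrary: \<sigma> \<tau>) (auto simp: ty_lift_comp)

lemma case_nat_TVar [simp]: "case_nat (TVar 0) (\<lambda>n. TVar (Suc n)) = TVar"
  by (rule ext) (simp split: nat.split)

lemma ty_tsubst_TVar [simp]: "ty_tsubst TVar A = A"
  by (induction A) auto

lemma ty_tsubst_cong: "(\<And>n. n \<in> ty_ftv A \<Longrightarrow> \<sigma> n = \<tau> n) \<Longrightarrow> ty_tsubst \<sigma> A = ty_tsubst \<tau> A"
proof (induction A arbitrary: \<sigma> \<tau>)
  case (All A)
  show ?case using All.prems by (auto intro!: All.IH split: nat.split)
next
  case (Fun A B)
  have "ty_tsubst \<sigma> A = ty_tsubst \<tau> A" "ty_tsubst \<sigma> B = ty_tsubst \<tau> B"
    by (rule Fun.IH, use Fun.prems in simp)+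
  then show ?case by simp
qed auto

text \<open>The instantiation cancels the shift in \<open>ty_lift\<close>, so in the quantifier case
  of \<open>cand_red\<close> the instance of the body is a single substitution extended by
  \<open>B\<close>.\<close>

lemma ty_tinst_lift: "ty_tinst B (ty_tsubst (ty_lift \<sigma>) A) = ty_tsubst (case_nat B \<sigma>) A"
proof -
  have "(\<lambda>n. ty_tsubst (case_nat B TVar) (ty_lift \<sigma> n)) = case_nat B \<sigma>"
    by (rule ext) (simp split: nat.split add: ty_tsubst_tren)
  then show ?thesis by (simp add: ty_tinst_def ty_tsubst_tsubst)
qed

section \<open>Type substitution in metaterms\<close>

lemma mt_tsubst_cong: "(\<And>n. n \<in> mt_ftv M \<Longrightarrow> \<sigma> n = \<tau> n) \<Longrightarrow> mt_tsubst \<sigma> M = mt_tsubst \<tau> M"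
proof (induction M arbitrary: \<sigma> \<tau>)
  case (TLam M)
  show ?case using TLam.prems by (auto intro!: TLam.IH split: nat.split)
next
  case (App M N)
  have "mt_tsubst \<sigma> M = mt_tsubst \<tau> M" "mt_tsubst \<sigma> N = mt_tsubst \<tau> N"
    by (rule App.IH, use App.prems in simp)+
  then show ?case by simp
next
  case (Seq M N)
  have "mt_tsubst \<sigma> M = mt_tsubst \<tau> M" "mt_tsubst \<sigma> N = mt_tsubst \<tau> N"
    by (rule Seq.IH, use Seq.prems in simp)+
  then show ?case by simp
next
  case (Nu M)
  show ?case using Nu.prems by (auto intro!: Nu.IH)
next
  case (Lam M)
  show ?case using Lam.prems by (auto intro!: Lam.IH)
next
  case (TApp M A)
  have "mt_tsubst \<sigma> M = mt_tsubst \<tau> M" by (rule TApp.IH) (use TApp.prems in simp)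
  moreover have "ty_tsubst \<sigma> A = ty_tsubst \<tau> A" by (rule ty_tsubst_cong) (use TApp.prems in simp)
  ultimately show ?case by simp
next
  case (Ver A M)
  have "mt_tsubst \<sigma> M = mt_tsubst \<tau> M" by (rule Ver.IH) (use Ver.prems in simp)
  moreover have "ty_tsubst \<sigma> A = ty_tsubst \<tau> A" by (rule ty_tsubst_cong) (use Ver.prems in simp)
  ultimately show ?case by simp
qed (auto intro!: ty_tsubst_cong)

lemma mt_tsubst_TVar [simp]: "mt_tsubst TVar M = M"
  by (induction M) auto


subsection \<open>Renaming of eigenvariables\<close>

lemma ty_eren_eren: "ty_eren f (ty_eren g A) = ty_eren (\<lambda>n. f (g n)) A"
  by (induction A) auto

lemma mt_eren_eren: "mt_eren f (mt_eren g M) = mt_eren (\<lambda>n. f (g n)) M"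
proof (induction M arbitrary: f g)
  case (Nu M)
  have "(\<lambda>n. up f (up g n)) = up (\<lambda>n. f (g n))"
    by (rule ext) (simp split: nat.split add: up_def)
  with Nu show ?case by simp
qed (auto simp: ty_eren_eren)

lemma ty_eren_tren: "ty_eren f (ty_tren g A) = ty_tren g (ty_eren f A)"
  by (induction A arbitrary: g) auto

lemma ty_eren_tsubst: "ty_eren f (ty_tsubst \<sigma> A) = ty_tsubst (\<lambda>n. ty_eren f (\<sigma> n)) (ty_eren f A)"
proof (induction A arbitrary: \<sigma>)
  case (All A)
  have "(\<lambda>n. ty_eren f (ty_lift \<sigma> n)) = ty_lift (\<lambda>n. ty_eren f (\<sigma> n))"
    by (rule ext) (simp split: nat.split add: ty_eren_tren)
  with All show ?case by simp
qed auto

lemma ty_eren_tinst: "ty_eren f (ty_tinst B A) = ty_tinst (ty_eren f B) (ty_eren f A)"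
proof -
  have "(\<lambda>n. ty_eren f (case_nat B TVar n)) = case_nat (ty_eren f B) TVar"
    by (rule ext) (simp split: nat.split)
  then show ?thesis by (simp add: ty_tinst_def ty_eren_tsubst)
qed

lemma mt_eren_vren: "mt_eren f (mt_vren g M) = mt_vren g (mt_eren f M)"
  by (induction M arbitrary: f g) auto

lemma mt_eren_tsubst: "mt_eren f (mt_tsubst \<sigma> M) = mt_tsubst (\<lambda>n. ty_eren f (\<sigma> n)) (mt_eren f M)"
proof (induction M arbitrary: f \<sigma>)
  case (TLam M)
  have "(\<lambda>n. ty_eren f (ty_lift \<sigma> n)) = ty_lift (\<lambda>n. ty_eren f (\<sigma> n))"
    by (rule ext) (simp split: nat.split add: ty_eren_tren)
  with TLam show ?case by simp
next
  case (Nu M)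
  then show ?case by (simp add: ty_eren_eren)
qed (auto simp: ty_eren_tsubst)

lemma mt_eren_subst: "mt_eren f (mt_subst \<sigma> M) = mt_subst (\<lambda>n. mt_eren f (\<sigma> n)) (mt_eren f M)"
proof (induction M arbitrary: f \<sigma>)
  case (Lam M)
  have "(\<lambda>n. mt_eren f (case_nat (Var 0) (\<lambda>n. mt_vren Suc (\<sigma> n)) n)) =
      case_nat (Var 0) (\<lambda>n. mt_vren Suc (mt_eren f (\<sigma> n)))"
    by (rule ext) (simp split: nat.split add: mt_eren_vren)
  with Lam show ?case by simp
next
  case (TLam M)
  then show ?case by (simp add: mt_eren_tsubst)
next
  case (Nu M)
  then show ?case by (simp add: mt_eren_eren)
qed auto

lemma mt_eren_inst: "mt_eren f (mt_inst N M) = mt_inst (mt_eren f N) (mt_eren f M)"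
proof -
  have "(\<lambda>n. mt_eren f (case_nat N Var n)) = case_nat (mt_eren f N) Var"
    by (rule ext) (simp split: nat.split)
  then show ?thesis by (simp add: mt_inst_def mt_eren_subst)
qed

lemma mt_eren_tinst: "mt_eren f (mt_tinst B M) = mt_tinst (ty_eren f B) (mt_eren f M)"
proof -
  have "(\<lambda>n. ty_eren f (case_nat B TVar n)) = case_nat (ty_eren f B) TVar"
    by (rule ext) (simp split: nat.split)
  then show ?thesis by (simp add: mt_tinst_def mt_eren_tsubst)
qed

text \<open>Only finitely many eigenvariables occur in an expression. A bound below which renamings
  have to agree expresses this without sets of free eigenvariables.\<close>

lemma ty_eren_cong_bounded: "\<exists>k. \<forall>f g. (\<forall>n<k. f n = g n) \<longrightarrow> ty_eren f A = ty_eren g A"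
proof (induction A)
  case (Eig a)
  show ?case by (rule exI [of _ "Suc a"]) auto
next
  case (Fun A B)
  then obtain k l where "\<forall>f g. (\<forall>n<k. f n = g n) \<longrightarrow> ty_eren f A = ty_eren g A"
    "\<forall>f g. (\<forall>n<l. f n = g n) \<longrightarrow> ty_eren f B = ty_eren g B" by blast
  then show ?case by (intro exI [of _ "max k l"]) (simp add: less_max_iff_disj)
qed auto

lemma mt_eren_cong_bounded: "\<exists>k. \<forall>f g. (\<forall>n<k. f n = g n) \<longrightarrow> mt_eren f M = mt_eren g M"
proof (induction M)
  case (App M N)
  then obtain k l where "\<forall>f g. (\<forall>n<k. f n = g n) \<longrightarrow> mt_eren f M = mt_eren g M"
    "\<forall>f g. (\<forall>n<l. f n = g n) \<longrightarrow> mt_eren f N = mt_eren g N" by blast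
  then show ?case by (intro exI [of _ "max k l"]) (simp add: less_max_iff_disj)
next
  case (Seq M N)
  then obtain k l where "\<forall>f g. (\<forall>n<k. f n = g n) \<longrightarrow> mt_eren f M = mt_eren g M"
    "\<forall>f g. (\<forall>n<l. f n = g n) \<longrightarrow> mt_eren f N = mt_eren g N" by blast
  then show ?case by (intro exI [of _ "max k l"]) (simp add: less_max_iff_disj)
next
  case (TApp M A)
  then obtain k l where "\<forall>f g. (\<forall>n<k. f n = g n) \<longrightarrow> mt_eren f M = mt_eren g M"
    "\<forall>f g. (\<forall>n<l. f n = g n) \<longrightarrow> ty_eren f A = ty_eren g A"
    using ty_eren_cong_bounded [of A] by blast
  then show ?case by (intro exI [of _ "max k l"]) (simp add: less_max_iff_disj)
next
  case (Ver A M)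
  then obtain k l where "\<forall>f g. (\<forall>n<k. f n = g n) \<longrightarrow> mt_eren f M = mt_eren g M"
    "\<forall>f g. (\<forall>n<l. f n = g n) \<longrightarrow> ty_eren f A = ty_eren g A"
    using ty_eren_cong_bounded [of A] by blast
  then show ?case by (intro exI [of _ "max k l"]) (simp add: less_max_iff_disj)
next
  case (Gen A)
  then show ?case using ty_eren_cong_bounded [of A] by simp
next
  case (Nu M)
  then obtain k where k: "\<And>f g. (\<forall>n<k. f n = g n) \<Longrightarrow> mt_eren f M = mt_eren g M" by blast
  \<comment> \<open>The bound of the body serves again: \<open>up f\<close> and \<open>up g\<close>
    agree at \<open>0\<close>, and at \<open>Suc n\<close> whenever \<open>f\<close> and
    \<open>g\<close> agree at \<open>n\<close>.\<close>
  have "mt_eren (up f) M = mt_eren (up g) M" if "\<forall>n<k. f n = g n" for f g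
    by (rule k) (use that in \<open>auto simp: up_def split: nat.split\<close>)
  then show ?case by auto
qed auto

section \<open>Reduction under renaming and in contexts\<close>

text \<open>Any renaming works, injective or not: \<open>ver_gen\<close>, the only rule that
  compares eigenvariables, asks for equality, which every map preserves, and \<open>up\<close> keeps
  the index bound by \<open>Nu\<close> apart from the free ones.\<close>

lemma step_eren: "M \<rightarrow>\<^sub>m N \<Longrightarrow> mt_eren f M \<rightarrow>\<^sub>m mt_eren f N"
proof (induction arbitrary: f rule: step.induct)
  case (ver_All A M)
  show ?case
    using step.ver_All [of "ty_eren f A" "mt_eren f M"]
    by (simp add: ty_eren_tinst ty_eren_eren mt_eren_eren)
next
  case (nu M)
  show ?case using step.nu [of "mt_eren f M"] by (simp add: mt_eren_eren)
qed (auto simp: mt_eren_inst mt_eren_tinst intro: step.intros)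

lemma steps_eren: "M \<rightarrow>\<^sub>m\<^sup>* N \<Longrightarrow> mt_eren f M \<rightarrow>\<^sub>m\<^sup>* mt_eren f N"
  by (induction rule: rtranclp_induct) (auto intro: step_eren rtranclp.rtrancl_into_rtrancl)

lemma steps_context:
  assumes "\<And>M N. M \<rightarrow>\<^sub>m N \<Longrightarrow> C M \<rightarrow>\<^sub>m C N" "M \<rightarrow>\<^sub>m\<^sup>* N"
  shows "C M \<rightarrow>\<^sub>m\<^sup>* C N"
  using assms(2) by (induction rule: rtranclp_induct)
    (auto intro: assms(1) rtranclp.rtrancl_into_rtrancl)


subsection \<open>Closed types and metaterms\<close>

text \<open>
  Closedness is invariance under substitution, so that no sets of free names are needed. It does not
  restrict the eigenvariables.
\<close>

definition closed_ty :: "ty \<Rightarrow> bool" where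
  "closed_ty A \<longleftrightarrow> (\<forall>\<sigma>. ty_tsubst \<sigma> A = A)"

definition closed_mt :: "mterm \<Rightarrow> bool" where
  "closed_mt M \<longleftrightarrow>
    (\<forall>f. mt_vren f M = M) \<and> (\<forall>\<sigma>. mt_tsubst \<sigma> M = M) \<and> (\<forall>\<sigma>. mt_subst \<sigma> M = M)"

lemma closed_ty_simps [simp]:
  "closed_ty (Eig a)"
  "closed_ty (A \<rightarrow>\<^sub>T B) \<longleftrightarrow> closed_ty A \<and> closed_ty B"
  by (auto simp: closed_ty_def)

lemma closed_mt_simps [simp]:
  "closed_mt Star"
  "closed_mt (App M N) \<longleftrightarrow> closed_mt M \<and> closed_mt N"
  "closed_mt (TApp M A) \<longleftrightarrow> closed_mt M \<and> closed_ty A"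
  "closed_mt (Gen A) \<longleftrightarrow> closed_ty A"
  by (auto simp: closed_mt_def closed_ty_def)

lemma closed_ty_tsubst: "(\<And>n. closed_ty (\<sigma> n)) \<Longrightarrow> closed_ty (ty_tsubst \<sigma> A)"
  by (simp add: closed_ty_def ty_tsubst_tsubst)

lemma closed_ty_ftv: "ty_ftv A = {} \<Longrightarrow> closed_ty A"
  using ty_tsubst_cong [of A _ TVar] by (simp add: closed_ty_def)

section \<open>Substitution in System F terms\<close>

lemma mt_tsubst_term:
  "is_term t \<Longrightarrow> mt_tsubst \<tau> (mt_tsubst \<sigma> t) = mt_tsubst (\<lambda>n. ty_tsubst \<tau> (\<sigma> n)) t"
  by (induction t arbitrary: \<sigma> \<tau>) (auto simp: ty_tsubst_tsubst ty_lift_comp)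

lemma is_term_tsubst [simp]: "is_term (mt_tsubst \<sigma> t) = is_term t"
  by (induction t arbitrary: \<sigma>) auto

text \<open>
  The substitutions below are closed up to variables: this class is stable under lifting, and on
  it the composition laws hold without commuting the three kinds of substitution in general.
\<close>

definition closing :: "(nat \<Rightarrow> mterm) \<Rightarrow> bool" where
  "closing \<delta> \<longleftrightarrow> (\<forall>n. closed_mt (\<delta> n) \<or> (\<exists>m. \<delta> n = Var m))"

lemma closing_cases:
  assumes "closing \<delta>"
  obtains "closed_mt (\<delta> n)" | m where "\<delta> n = Var m"
  using assms by (auto simp: closing_def)

lemma closing_closed: "(\<And>n. closed_mt (\<gamma> n)) \<Longrightarrow> closing \<gamma>"
  by (simp add: closing_def)

lemma closed_mtD [simp]:
  assumes "closed_mt M"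
  shows "mt_vren f M = M" "mt_tsubst \<sigma> M = M" "mt_subst \<tau> M = M"
  using assms by (auto simp: closed_mt_def)

lemma closing_lift:
  assumes "closing \<delta>"
  shows "closing (case_nat (Var 0) (\<lambda>n. mt_vren Suc (\<delta> n)))"
  unfolding closing_def
proof
  fix n
  show "closed_mt (case_nat (Var 0) (\<lambda>n. mt_vren Suc (\<delta> n)) n) \<or>
      (\<exists>m. case_nat (Var 0) (\<lambda>n. mt_vren Suc (\<delta> n)) n = Var m)"
  proof (cases n)
    case (Suc k)
    show ?thesis by (rule closing_cases [OF assms, of k]) (auto simp: Suc)
  qed auto
qed

lemma closing_tsubst [simp]: "closing \<delta> \<Longrightarrow> (\<lambda>n. mt_tsubst \<sigma> (\<delta> n)) = \<delta>"
proof
  fix n assume "closing \<delta>"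
  then show "mt_tsubst \<sigma> (\<delta> n) = \<delta> n" by (rule closing_cases [of _ n]) auto
qed

lemma vren_subst_term:
  "is_term t \<Longrightarrow> closing \<delta> \<Longrightarrow> mt_vren f (mt_subst \<delta> t) = mt_subst (\<lambda>n. mt_vren f (\<delta> n)) t"
proof (induction t arbitrary: \<delta> f)
  case (Lam t)
  have "(\<lambda>n. mt_vren (up f) (case_nat (Var 0) (\<lambda>n. mt_vren Suc (\<delta> n)) n)) =
      case_nat (Var 0) (\<lambda>n. mt_vren Suc (mt_vren f (\<delta> n)))"
  proof
    fix n
    show "mt_vren (up f) (case_nat (Var 0) (\<lambda>n. mt_vren Suc (\<delta> n)) n) =
        case_nat (Var 0) (\<lambda>n. mt_vren Suc (mt_vren f (\<delta> n))) n"
    proof (cases n)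
      case (Suc k)
      show ?thesis by (rule closing_cases [OF \<open>closing \<delta>\<close>, of k]) (auto simp: Suc)
    qed simp
  qed
  with Lam show ?case by (simp add: closing_lift)
next
  case (TLam t)
  have "(\<lambda>n. mt_tsubst (\<lambda>i. TVar (Suc i)) (mt_vren f (\<delta> n))) = (\<lambda>n. mt_vren f (\<delta> n))"
  proof
    fix n
    show "mt_tsubst (\<lambda>i. TVar (Suc i)) (mt_vren f (\<delta> n)) = mt_vren f (\<delta> n)"
      by (rule closing_cases [OF \<open>closing \<delta>\<close>, of n]) auto
  qed
  with TLam show ?case by simp
qed auto

lemma subst_subst_term:
  "is_term t \<Longrightarrow> closing \<delta> \<Longrightarrow> mt_subst \<tau> (mt_subst \<delta> t) = mt_subst (\<lambda>n. mt_subst \<tau> (\<delta> n)) t"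
proof (induction t arbitrary: \<delta> \<tau>)
  case (Lam t)
  have "(\<lambda>n. mt_subst (case_nat (Var 0) (\<lambda>n. mt_vren Suc (\<tau> n)))
      (case_nat (Var 0) (\<lambda>n. mt_vren Suc (\<delta> n)) n)) =
      case_nat (Var 0) (\<lambda>n. mt_vren Suc (mt_subst \<tau> (\<delta> n)))"
  proof
    fix n
    show "mt_subst (case_nat (Var 0) (\<lambda>n. mt_vren Suc (\<tau> n)))
        (case_nat (Var 0) (\<lambda>n. mt_vren Suc (\<delta> n)) n) =
        case_nat (Var 0) (\<lambda>n. mt_vren Suc (mt_subst \<tau> (\<delta> n))) n"
    proof (cases n)
      case (Suc k)
      show ?thesis by (rule closing_cases [OF \<open>closing \<delta>\<close>, of k]) (auto simp: Suc)
    qed simp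
  qed
  with Lam show ?case by (simp add: closing_lift)
next
  case (TLam t)
  have "(\<lambda>n. mt_subst (\<lambda>n. mt_tsubst (\<lambda>i. TVar (Suc i)) (\<tau> n)) (\<delta> n)) =
      (\<lambda>n. mt_tsubst (\<lambda>i. TVar (Suc i)) (mt_subst \<tau> (\<delta> n)))"
  proof
    fix n
    show "mt_subst (\<lambda>n. mt_tsubst (\<lambda>i. TVar (Suc i)) (\<tau> n)) (\<delta> n) =
        mt_tsubst (\<lambda>i. TVar (Suc i)) (mt_subst \<tau> (\<delta> n))"
      by (rule closing_cases [OF \<open>closing \<delta>\<close>, of n]) auto
  qed
  with TLam show ?case by simp
qed auto

text \<open>The values of \<open>\<delta>\<close> are variables or closed, so \<open>\<tau>\<close>
  fixes them and acts on \<open>t\<close> alone.\<close>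

lemma tsubst_subst_term:
  "is_term t \<Longrightarrow> closing \<delta> \<Longrightarrow> mt_tsubst \<tau> (mt_subst \<delta> t) = mt_subst \<delta> (mt_tsubst \<tau> t)"
proof (induction t arbitrary: \<delta> \<tau>)
  case (Var n)
  show ?case by (rule closing_cases [OF \<open>closing \<delta>\<close>, of n]) auto
qed (auto simp: closing_lift)

text \<open>Each of the three operations moves inwards to the values of \<open>\<sigma>\<close> or
  \<open>\<gamma>\<close>, which it leaves unchanged.\<close>

lemma closed_mt_subst_term:
  assumes t: "is_term t" and \<sigma>: "\<And>n. closed_ty (\<sigma> n)" and \<gamma>: "\<And>n. closed_mt (\<gamma> n)"
  shows "closed_mt (mt_subst \<gamma> (mt_tsubst \<sigma> t))"
proof -
  have "mt_tsubst \<tau> (mt_tsubst \<sigma> t) = mt_tsubst \<sigma> t" for \<tau>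
    using t \<sigma> by (simp add: mt_tsubst_term closed_ty_def)
  then show ?thesis using assms closing_closed [OF \<gamma>]
    unfolding closed_mt_def [of "mt_subst _ _"]
    by (simp add: vren_subst_term subst_subst_term tsubst_subst_term)
qed

text \<open>Identifies the contractum of \<open>beta\<close>, for an abstraction whose free
  variables are interpreted by \<open>\<gamma>\<close>, with its body under the extended
  valuation.\<close>

lemma inst_subst_term:
  assumes "is_term t" and \<gamma>: "\<And>n. closed_mt (\<gamma> n)"
  shows "mt_inst N (mt_subst (case_nat (Var 0) (\<lambda>n. mt_vren Suc (\<gamma> n))) t) =
    mt_subst (case_nat N \<gamma>) t"
proof -
  have "(\<lambda>n. mt_subst (case_nat N Var) (case_nat (Var 0) (\<lambda>n. mt_vren Suc (\<gamma> n)) n)) =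
      case_nat N \<gamma>"
    by (rule ext) (use \<gamma> in \<open>simp split: nat.split\<close>)
  then show ?thesis
    using assms closing_lift [OF closing_closed [OF \<gamma>]]
    by (simp only: mt_inst_def subst_subst_term)
qed

text \<open>The counterpart of \<open>inst_subst_term\<close> for \<open>tbeta\<close>: here the
  type substitution is extended.\<close>

lemma tinst_subst_term:
  assumes t: "is_term t" and \<gamma>: "\<And>n. closed_mt (\<gamma> n)"
  shows "mt_tinst B (mt_subst \<gamma> (mt_tsubst (ty_lift \<sigma>) t)) = mt_subst \<gamma> (mt_tsubst (case_nat B \<sigma>) t)"
proof -
  have "(\<lambda>n. ty_tsubst (case_nat B TVar) (ty_lift \<sigma> n)) = case_nat B \<sigma>"
    by (rule ext) (simp split: nat.split add: ty_tsubst_tren)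
  then show ?thesis
    using t closing_closed [OF \<gamma>]
    by (simp add: mt_tinst_def tsubst_subst_term mt_tsubst_term)
qed


subsection \<open>Reducibility candidates\<close>

definition cand :: "ty \<Rightarrow> mterm set \<Rightarrow> bool" where
  "cand A R \<longleftrightarrow> closed_ty A \<and> Gen A \<in> R \<and>
    (\<forall>M\<in>R. closed_mt M \<and> Ver A M \<rightarrow>\<^sub>m\<^sup>* Star) \<and>
    (\<forall>M N. closed_mt M \<longrightarrow> M \<rightarrow>\<^sub>m\<^sup>* N \<longrightarrow> N \<in> R \<longrightarrow> M \<in> R)"

text \<open>The quantifier ranges over all candidates of all types rather than over instances of
  \<open>A\<close>, which keeps the recursion structural despite impredicativity. The clause for
  \<open>Eig a\<close> is the largest candidate of that type.\<close>

primrec red :: "(nat \<Rightarrow> mterm set) \<Rightarrow> ty \<Rightarrow> mterm set" where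
  "red \<rho> (TVar n) = \<rho> n"
| "red \<rho> (Eig a) = {M. closed_mt M \<and> Ver (Eig a) M \<rightarrow>\<^sub>m\<^sup>* Star}"
| "red \<rho> (A \<rightarrow>\<^sub>T B) = {M. closed_mt M \<and> (\<forall>N\<in>red \<rho> A. App M N \<in> red \<rho> B)}"
| "red \<rho> (All A) = {M. closed_mt M \<and> (\<forall>B R. cand B R \<longrightarrow> TApp M B \<in> red (case_nat R \<rho>) A)}"

lemma candD:
  assumes "cand A R"
  shows "closed_ty A" "Gen A \<in> R" "M \<in> R \<Longrightarrow> closed_mt M" "M \<in> R \<Longrightarrow> Ver A M \<rightarrow>\<^sub>m\<^sup>* Star"
    "closed_mt M \<Longrightarrow> M \<rightarrow>\<^sub>m\<^sup>* N \<Longrightarrow> N \<in> R \<Longrightarrow> M \<in> R"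
  using assms unfolding cand_def by blast+

section \<open>Candidates for the type formers\<close>

lemma cand_Eig: "cand (Eig a) {M. closed_mt M \<and> Ver (Eig a) M \<rightarrow>\<^sub>m\<^sup>* Star}"
  unfolding cand_def
proof (intro conjI ballI allI impI)
  fix M N
  assume "closed_mt M" "M \<rightarrow>\<^sub>m\<^sup>* N" "N \<in> {M. closed_mt M \<and> Ver (Eig a) M \<rightarrow>\<^sub>m\<^sup>* Star}"
  moreover have "Ver (Eig a) M \<rightarrow>\<^sub>m\<^sup>* Ver (Eig a) N"
    by (rule steps_context [OF step.Ver \<open>M \<rightarrow>\<^sub>m\<^sup>* N\<close>])
  ultimately show "M \<in> {M. closed_mt M \<and> Ver (Eig a) M \<rightarrow>\<^sub>m\<^sup>* Star}"
    by (auto intro: rtranclp_trans)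
qed (auto intro: step.ver_gen)

text \<open>Applied to \<open>N\<close> in \<open>R\<close>, \<open>Gen\<close> of the function type
  reduces to \<open>Gen B\<close>, because the guard \<open>Ver A N\<close> reaches
  \<open>Star\<close>. Conversely, \<open>ver_Fun\<close> tests \<open>M\<close> on
  \<open>Gen A\<close>, which lies in \<open>R\<close>.\<close>

lemma cand_Fun:
  assumes A: "cand A R" and B: "cand B S"
  shows "cand (A \<rightarrow>\<^sub>T B) {M. closed_mt M \<and> (\<forall>N\<in>R. App M N \<in> S)}" (is "cand _ ?T")
  unfolding cand_def
proof (intro conjI ballI allI impI)
  show "closed_ty (A \<rightarrow>\<^sub>T B)" using candD(1) [OF A] candD(1) [OF B] by simp
  have "App (Gen (A \<rightarrow>\<^sub>T B)) N \<in> S" if N: "N \<in> R" for N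
  proof -
    have "App (Gen (A \<rightarrow>\<^sub>T B)) N \<rightarrow>\<^sub>m App (Lam (Ver A (Var 0) \<triangleright> Gen B)) N"
      by (intro step.AppL step.gen_Fun)
    moreover have "App (Lam (Ver A (Var 0) \<triangleright> Gen B)) N \<rightarrow>\<^sub>m (Ver A N \<triangleright> Gen B)"
      using step.beta [of "Ver A (Var 0) \<triangleright> Gen B" N] by (simp add: mt_inst_def)
    moreover have "(Ver A N \<triangleright> Gen B) \<rightarrow>\<^sub>m\<^sup>* (Star \<triangleright> Gen B)"
      by (rule steps_context [OF step.SeqL candD(4) [OF A N]])
    moreover have "(Star \<triangleright> Gen B) \<rightarrow>\<^sub>m Gen B" by (rule step.seq)
    ultimately have "App (Gen (A \<rightarrow>\<^sub>T B)) N \<rightarrow>\<^sub>m\<^sup>* Gen B"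
      by (meson converse_rtranclp_into_rtranclp rtranclp.rtrancl_into_rtrancl)
    moreover have "closed_mt (App (Gen (A \<rightarrow>\<^sub>T B)) N)"
      using candD(3) [OF A N] candD(1) [OF A] candD(1) [OF B] by simp
    ultimately show ?thesis using candD(5) [OF B] candD(2) [OF B] by blast
  qed
  then show "Gen (A \<rightarrow>\<^sub>T B) \<in> ?T" using candD(1) [OF A] candD(1) [OF B] by simp
next
  fix M assume M: "M \<in> ?T"
  then show "closed_mt M" by simp
  have "App M (Gen A) \<in> S" using M candD(2) [OF A] by simp
  then show "Ver (A \<rightarrow>\<^sub>T B) M \<rightarrow>\<^sub>m\<^sup>* Star"
    by (meson step.ver_Fun candD(4) [OF B] converse_rtranclp_into_rtranclp)
next
  fix M N assume M: "closed_mt M" "M \<rightarrow>\<^sub>m\<^sup>* N" "N \<in> ?T"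
  have "App M P \<in> S" if "P \<in> R" for P
  proof (rule candD(5) [OF B])
    show "closed_mt (App M P)" using M(1) candD(3) [OF A that] by simp
    show "App M P \<rightarrow>\<^sub>m\<^sup>* App N P" by (rule steps_context [OF step.AppL M(2)])
    show "App N P \<in> S" using M(3) that by simp
  qed
  with M(1) show "M \<in> ?T" by simp
qed

text \<open>Take \<open>c\<close> above every eigenvariable of \<open>M\<close> and
  \<open>A\<close>. The renaming differs from \<open>Suc\<close> only at \<open>c\<close>, which it
  sends to the index \<open>0\<close> left vacant by the shift.\<close>

lemma fresh_eig:
  obtains c where "mt_eren (\<lambda>n. if n = c then 0 else Suc n) M = mt_eren Suc M"
    "ty_eren (\<lambda>n. if n = c then 0 else Suc n) A = ty_eren Suc A"
proof -
  obtain k l where "\<forall>f g. (\<forall>n<k. f n = g n) \<longrightarrow> mt_eren f M = mt_eren g M"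
    "\<forall>f g. (\<forall>n<l. f n = g n) \<longrightarrow> ty_eren f A = ty_eren g A"
    using mt_eren_cong_bounded [of M] ty_eren_cong_bounded [of A] by blast
  then show ?thesis by (intro that [of "max k l"]) (simp_all add: less_max_iff_disj)
qed

text \<open>\<open>T\<close> stands for the interpretation of the body as a function of the
  candidate chosen for the bound variable. At each \<open>B\<close>, \<open>Gen (All A)\<close>
  reduces to \<open>Gen\<close> of the instance, which lies in \<open>T R\<close>.\<close>

lemma cand_All:
  assumes c: "closed_ty (All A)"
    and T: "\<And>B R. cand B R \<Longrightarrow> cand (ty_tinst B A) (T R)"
  shows "cand (All A) {M. closed_mt M \<and> (\<forall>B R. cand B R \<longrightarrow> TApp M B \<in> T R)}" (is "cand _ ?T")
  unfolding cand_def [of "All A"]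
proof (intro conjI ballI allI impI)
  show "closed_ty (All A)" by (rule c)
  have "TApp (Gen (All A)) B \<in> T R" if R: "cand B R" for B R
  proof (rule candD(5) [OF T [OF R]])
    show "closed_mt (TApp (Gen (All A)) B)" using c candD(1) [OF R] by simp
    show "Gen (ty_tinst B A) \<in> T R" by (rule candD(2) [OF T [OF R]])
    have "TApp (Gen (All A)) B \<rightarrow>\<^sub>m TApp (TLam (Gen A)) B"
      by (intro step.TApp step.gen_All)
    moreover have "TApp (TLam (Gen A)) B \<rightarrow>\<^sub>m Gen (ty_tinst B A)"
      using step.tbeta [of "Gen A" B] by (simp add: mt_tinst_def ty_tinst_def)
    ultimately show "TApp (Gen (All A)) B \<rightarrow>\<^sub>m\<^sup>* Gen (ty_tinst B A)" by auto
  qed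
  then show "Gen (All A) \<in> ?T" using c by simp
next
  fix M assume M: "M \<in> ?T"
  then show "closed_mt M" by simp
  \<comment> \<open>The reduction at a fresh \<open>Eig c\<close> is renamed to one at the index \<open>0\<close> bound by \<open>Nu\<close>.\<close>
  obtain c where fr: "mt_eren (\<lambda>n. if n = c then 0 else Suc n) M = mt_eren Suc M"
    "ty_eren (\<lambda>n. if n = c then 0 else Suc n) A = ty_eren Suc A" by (rule fresh_eig)
  have "Ver (ty_tinst (Eig c) A) (TApp M (Eig c)) \<rightarrow>\<^sub>m\<^sup>* Star"
    using M cand_Eig candD(4) [OF T [OF cand_Eig]] by blast
  from steps_eren [OF this, of "\<lambda>n. if n = c then 0 else Suc n"]
  have "Ver (ty_tinst (Eig 0) (ty_eren Suc A)) (TApp (mt_eren Suc M) (Eig 0)) \<rightarrow>\<^sub>m\<^sup>* Star"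
    by (simp add: fr ty_eren_tinst)
  from steps_context [OF step.Nu this]
  have "Ver (All A) M \<rightarrow>\<^sub>m\<^sup>* Nu Star" by (meson step.ver_All converse_rtranclp_into_rtranclp)
  moreover have "Nu Star \<rightarrow>\<^sub>m Star" using step.nu [of Star] by simp
  ultimately show "Ver (All A) M \<rightarrow>\<^sub>m\<^sup>* Star" by (rule rtranclp.rtrancl_into_rtrancl)
next
  fix M N assume M: "closed_mt M" "M \<rightarrow>\<^sub>m\<^sup>* N" "N \<in> ?T"
  have "TApp M B \<in> T R" if R: "cand B R" for B R
  proof (rule candD(5) [OF T [OF R]])
    show "closed_mt (TApp M B)" using M(1) candD(1) [OF R] by simp
    show "TApp M B \<rightarrow>\<^sub>m\<^sup>* TApp N B" by (rule steps_context [OF step.TApp M(2)])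
    show "TApp N B \<in> T R" using M(3) R by simp
  qed
  with M(1) show "M \<in> ?T" by simp
qed

text \<open>Each clause of \<open>red\<close> has its candidate lemma. With \<open>\<sigma>\<close>
  and \<open>\<rho>\<close> arbitrary, the induction hypothesis covers their extension by any
  candidate below a quantifier.\<close>

lemma cand_red: "(\<And>n. cand (\<sigma> n) (\<rho> n)) \<Longrightarrow> cand (ty_tsubst \<sigma> A) (red \<rho> A)"
proof (induction A arbitrary: \<sigma> \<rho>)
  case (Eig a)
  show ?case using cand_Eig by simp
next
  case (Fun A B)
  then show ?case using cand_Fun by simp
next
  case (All A)
  have "closed_ty (ty_tsubst \<sigma> (All A))"
    by (intro closed_ty_tsubst candD(1) [OF All.prems])
  moreover have "cand (ty_tinst B (ty_tsubst (ty_lift \<sigma>) A)) (red (case_nat R \<rho>) A)"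
    if "cand B R" for B R
    unfolding ty_tinst_lift by (rule All.IH) (use that All.prems in \<open>simp split: nat.split\<close>)
  ultimately show ?case using cand_All by simp
qed simp

section \<open>Interpretation of renamed and substituted types\<close>

lemma red_tren: "red \<rho> (ty_tren f A) = red (\<lambda>n. \<rho> (f n)) A"
proof (induction A arbitrary: \<rho> f)
  case (All A)
  have "(\<lambda>n. case_nat R \<rho> (up f n)) = case_nat R (\<lambda>n. \<rho> (f n))" for R :: "mterm set"
    by (rule ext) (simp split: nat.split add: up_def)
  with All show ?case by simp
qed auto

lemma red_tsubst: "red \<rho> (ty_tsubst \<sigma> A) = red (\<lambda>n. red \<rho> (\<sigma> n)) A"
proof (induction A arbitrary: \<rho> \<sigma>)
  case (All A)
  have "(\<lambda>n. red (case_nat R \<rho>) (ty_lift \<sigma> n)) = case_nat R (\<lambda>n. red \<rho> (\<sigma> n))" for R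
    by (rule ext) (simp split: nat.split add: red_tren)
  with All show ?case by simp
qed auto

lemma red_tinst: "red \<rho> (ty_tinst B A) = red (case_nat (red \<rho> B) \<rho>) A"
proof -
  have "(\<lambda>n. red \<rho> (case_nat B TVar n)) = case_nat (red \<rho> B) \<rho>"
    by (rule ext) (simp split: nat.split)
  then show ?thesis by (simp add: ty_tinst_def red_tsubst)
qed

section \<open>Soundness of the interpretation\<close>

text \<open>An abstraction is reducible because its application to a reducible argument reduces to
  the body under the extended valuation, and candidates are closed under expansion. Closed values of
  \<open>\<gamma>\<close> at all indices make the interpreted term closed.\<close>

lemma typing_red:
  assumes "\<Gamma> \<turnstile> t : A" "is_term t" "\<And>n. cand (\<sigma> n) (\<rho> n)"
    and "\<And>n. closed_mt (\<gamma> n)" "\<And>n A. \<Gamma> n = Some A \<Longrightarrow> \<gamma> n \<in> red \<rho> A"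
  shows "mt_subst \<gamma> (mt_tsubst \<sigma> t) \<in> red \<rho> A"
  using assms
proof (induction arbitrary: \<sigma> \<rho> \<gamma> rule: typing.induct)
  case (Var \<Gamma> n A)
  then show ?case by simp
next
  case (Lam A \<Gamma> t B)
  let ?L = "mt_subst \<gamma> (mt_tsubst \<sigma> (Lam t))"
  have cL: "closed_mt ?L"
    by (rule closed_mt_subst_term [OF Lam.prems(1) candD(1) [OF Lam.prems(2)] Lam.prems(3)])
  have "App ?L N \<in> red \<rho> B" if N: "N \<in> red \<rho> A" for N
  proof (rule candD(5) [OF cand_red [of \<sigma>, OF Lam.prems(2)]])
    have cN: "closed_mt N" by (rule candD(3) [OF cand_red [of \<sigma>, OF Lam.prems(2)] N])
    with cL show "closed_mt (App ?L N)" by simp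
    show "App ?L N \<rightarrow>\<^sub>m\<^sup>* mt_subst (case_nat N \<gamma>) (mt_tsubst \<sigma> t)"
      using step.beta [of _ N] inst_subst_term [of "mt_tsubst \<sigma> t" \<gamma> N] Lam.prems
      by (metis is_term.simps(2) is_term_tsubst mt_subst.simps(2) mt_tsubst.simps(2) r_into_rtranclp)
    show "mt_subst (case_nat N \<gamma>) (mt_tsubst \<sigma> t) \<in> red \<rho> B"
      by (rule Lam.IH) (use Lam.prems N cN in \<open>auto split: nat.splits\<close>)
  qed
  with cL show ?case by simp
next
  case (App \<Gamma> t A B s)
  have "mt_subst \<gamma> (mt_tsubst \<sigma> t) \<in> red \<rho> (A \<rightarrow>\<^sub>T B)"
    by (rule App.IH(1)) (use App.prems in auto)
  moreover have "mt_subst \<gamma> (mt_tsubst \<sigma> s) \<in> red \<rho> A"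
    by (rule App.IH(2)) (use App.prems in auto)
  ultimately show ?case by simp
next
  case (TLam \<Gamma> t A)
  let ?L = "mt_subst \<gamma> (mt_tsubst \<sigma> (TLam t))"
  have cL: "closed_mt ?L"
    by (rule closed_mt_subst_term [OF TLam.prems(1) candD(1) [OF TLam.prems(2)] TLam.prems(3)])
  have "TApp ?L B \<in> red (case_nat R \<rho>) A" if R: "cand B R" for B R
  proof -
    have c: "cand (case_nat B \<sigma> n) (case_nat R \<rho> n)" for n
      using R TLam.prems(2) by (simp split: nat.split)
    show ?thesis
    proof (rule candD(5) [OF cand_red [OF c]])
      show "closed_mt (TApp ?L B)" using cL candD(1) [OF R] by simp
      \<comment> \<open>Below \<open>TLam\<close> the values of \<open>\<gamma>\<close> are shifted,
        which does not change them as they are closed.\<close>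
      have "?L = TLam (mt_subst \<gamma> (mt_tsubst (ty_lift \<sigma>) t))"
        using closing_closed [OF TLam.prems(3)] by simp
      then show "TApp ?L B \<rightarrow>\<^sub>m\<^sup>* mt_subst \<gamma> (mt_tsubst (case_nat B \<sigma>) t)"
        using step.tbeta [of "mt_subst \<gamma> (mt_tsubst (ty_lift \<sigma>) t)" B]
          tinst_subst_term [of t \<gamma> B \<sigma>] TLam.prems by auto
      \<comment> \<open>By \<open>red_tren\<close>, the shifted types of the environment mean under
        \<open>case_nat R \<rho>\<close> what the original ones mean under \<open>\<rho>\<close>, so
        \<open>\<gamma>\<close> still fits.\<close>
      show "mt_subst \<gamma> (mt_tsubst (case_nat B \<sigma>) t) \<in> red (case_nat R \<rho>) A"
        by (rule TLam.IH) (use TLam.prems c in \<open>auto simp: red_tren\<close>)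
    qed
  qed
  with cL show ?case by simp
next
  case (TApp \<Gamma> t A B)
  have "mt_subst \<gamma> (mt_tsubst \<sigma> t) \<in> red \<rho> (All A)"
    by (rule TApp.IH) (use TApp.prems in auto)
  \<comment> \<open>The impredicative step: the interpretation of \<open>B\<close> is itself a
    candidate, so the quantifier may be instantiated with it.\<close>
  moreover have "cand (ty_tsubst \<sigma> B) (red \<rho> B)"
    by (rule cand_red) (rule TApp.prems(2))
  ultimately show ?case by (simp add: red_tinst)
qed

text \<open>The free variables of a typable term lie in the domain of its environment. This
  reconciles a closed valuation with \<open>gen_subst\<close>, which keeps undeclared
  variables.\<close>

lemma mt_subst_cong_typing:
  assumes "\<Gamma> \<turnstile> t : A" "\<And>n. \<Gamma> n \<noteq> None \<Longrightarrow> \<gamma> n = \<delta> n"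
  shows "mt_subst \<gamma> t = mt_subst \<delta> t"
  using assms
proof (induction arbitrary: \<gamma> \<delta> rule: typing.induct)
  case (Lam A \<Gamma> t B)
  show ?case by (simp, rule Lam.IH) (simp add: Lam.prems split: nat.splits)
next
  case (TLam \<Gamma> t A)
  show ?case by (simp, rule TLam.IH) (simp add: TLam.prems)
next
  case (App \<Gamma> t A B s)
  show ?case using App.IH(1) [OF App.prems] App.IH(2) [OF App.prems] by simp
next
  case (TApp \<Gamma> t A B)
  show ?case using TApp.IH [OF TApp.prems] by simp
qed simp

theorem theorem4p12:
  fixes \<Gamma> :: env and t :: mterm and A :: ty
  assumes "finite (dom \<Gamma>)"
    and "is_term t"
    and "\<forall>B \<in> ran \<Gamma>. ty_ftv B = {}"
    and "mt_ftv t = {}"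
    and "ty_ftv A = {}"
    and "\<Gamma> \<turnstile> t : A"
  shows "Ver A (gen_subst \<Gamma> t) \<rightarrow>\<^sub>m\<^sup>* Star"
proof -
  \<comment> \<open>The derivation may contain free type-variables, although \<open>\<Gamma>\<close>, \<open>t\<close> and \<open>A\<close> do not: these are
    interpreted by \<open>Eig 0\<close>. The value of \<open>\<gamma>\<close> outside of \<open>\<Gamma>\<close> is irrelevant; \<open>Star\<close> is closed.\<close>
  define \<sigma> :: "nat \<Rightarrow> ty" where "\<sigma> = (\<lambda>_. Eig 0)"
  define \<rho> :: "nat \<Rightarrow> mterm set"
    where "\<rho> = (\<lambda>_. {M. closed_mt M \<and> Ver (Eig 0) M \<rightarrow>\<^sub>m\<^sup>* Star})"
  define \<gamma> where "\<gamma> n = (case \<Gamma> n of None \<Rightarrow> Star | Some B \<Rightarrow> Gen B)" for n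
  have \<rho>: "cand (\<sigma> n) (\<rho> n)" for n unfolding \<sigma>_def \<rho>_def by (rule cand_Eig)
  \<comment> \<open>\<open>\<sigma>\<close> fixes a type without free type-variables, so its
    interpretation is a candidate of the type itself and not merely of an instance.\<close>
  have red: "cand B (red \<rho> B)" if "ty_ftv B = {}" for B
    using cand_red [OF \<rho>, where A = B] closed_ty_ftv [OF that] by (simp add: closed_ty_def)
  have \<Gamma>: "cand B (red \<rho> B)" if "\<Gamma> n = Some B" for n B
    using assms(3) that by (intro red) (auto simp: ran_def)
  have "mt_subst \<gamma> (mt_tsubst \<sigma> t) \<in> red \<rho> A"
  proof (rule typing_red [OF assms(6,2) \<rho>])
    show "closed_mt (\<gamma> n)" for n
      using candD(1) [OF \<Gamma>] by (auto simp: \<gamma>_def split: option.split)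
    show "\<gamma> n \<in> red \<rho> B" if "\<Gamma> n = Some B" for n B
      using candD(2) [OF \<Gamma> [OF that]] that by (simp add: \<gamma>_def)
  qed
  moreover have "mt_tsubst \<sigma> t = t"
    using mt_tsubst_cong [of t \<sigma> TVar] assms(4) by simp
  moreover have "mt_subst \<gamma> t = gen_subst \<Gamma> t"
    unfolding gen_subst_def
    by (rule mt_subst_cong_typing [OF assms(6)]) (auto simp: \<gamma>_def)
  ultimately show ?thesis using candD(4) [OF red [OF assms(5)]] by simp
qed

end
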